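(* Let $m_1\ge1$ and $m_2\ge4$ be integers with $m_2\ge m_1+1$, and let $\beta_0=0,\beta_1,\dots,\beta_{m_1}$ be pairwise distinct non-negative integers with $\max_j\beta_j=m_2$. Let $H$ be real with $\log H\ge m_2(\log m_2)^2e^{m_2(\log m_2)^2}$. Then for every $(\lambda_0,\lambda_1,\dots,\lambda_{m_1})\in\mathbb{Z}_{\mathbb{I}}^{m_1+1}\setminus\{0\}$ with $\max_{1\le i\le m_1}|\lambda_i|\le H$, the polynomial $P(x)=\lambda_0+\lambda_1x^{\beta_1}+\dots+\lambda_{m_1}x^{\beta_{m_1}}$ satisfies \[ |P(e)|>H^{-m_1-\frac{\rho(m_1^2+3m_1+2)\log m_2}{\log\log H}}, \] where one may take $\rho=12.88$ for all $m_2\ge4$, and $\rho=2$ when $m_2\ge11$.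
   Context: $\mathbb{I}$ is an imaginary quadratic field and $\mathbb{Z}_{\mathbb{I}}$ its ring of integers. *)

theory Defs
  imports "HOL-Analysis.Analysis" "HOL-Computational_Algebra.Polynomial"
begin

definition imag_quad_field :: "int \<Rightarrow> complex set" where
  "imag_quad_field d = {of_rat a + of_rat b * (\<i> * complex_of_real (sqrt (of_int (- d)))) | a b. True}"

definition alg_int :: "complex \<Rightarrow> bool" where
  "alg_int z \<longleftrightarrow> (\<exists>p :: int poly. lead_coeff p = 1 \<and> poly (map_poly of_int p) z = 0)"

definition ring_of_integers_iqf :: "int \<Rightarrow> complex set" where
  "ring_of_integers_iqf d = {z \<in> imag_quad_field d. alg_int z}"

definition bound_exp :: "real \<Rightarrow> nat \<Rightarrow> nat \<Rightarrow> real \<Rightarrow> real" where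
  "bound_exp \<rho> m1 m2 H =
     - real m1 - \<rho> * (real m1 ^ 2 + 3 * real m1 + 2) * ln (real m2) / ln (ln H)"

end

theory Submission
  imports Defs "HOL-Computational_Algebra.Primes"
begin

text \<open>
  Write \<open>m = m1\<close>, \<open>n = m2\<close>, \<open>N = m + 1\<close>. For an integer \<open>l\<close> and \<open>k \<le> m\<close> let \<open>f\<^sub>k\<close> be the product of
  all \<open>(t - \<beta>\<^sub>j)\<^sup>l\<close> divided by \<open>t - \<beta>\<^sub>k\<close>, and let \<open>F\<^sub>k\<close> be the sum of all derivatives of \<open>f\<^sub>k\<close>. By Hermite's
  identity \<open>F\<^sub>k(\<beta>\<^sub>j)\<close> is close to \<open>exp \<beta>\<^sub>j F\<^sub>k(0)\<close>, with an error of size \<open>n\<^bsup>N l\<^esup>\<close>, while all \<open>F\<^sub>k(\<beta>\<^sub>j)\<close>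
  are divisible by \<open>(l - 1)!\<close>. If \<open>l\<close> is coprime to \<open>n!\<close> and \<open>p\<close> is a prime divisor of \<open>l\<close>, then the
  matrix \<open>F\<^sub>k(\<beta>\<^sub>j) / (l - 1)!\<close> is diagonal and invertible modulo \<open>p\<close>, so some combination
  \<open>\<Sum>j. \<lambda>\<^sub>j F\<^sub>k(\<beta>\<^sub>j) / (l - 1)!\<close> is a nonzero integer of the imaginary quadratic field and has
  absolute value at least one. Hence \<open>\<bar>P(e)\<bar>\<close> is at least \<open>(l - 1)! / (2 \<bar>F\<^sub>k(0)\<bar>)\<close> as soon as the error
  terms, multiplied by \<open>H\<close>, are at most \<open>(l - 1)! / 2\<close>. The least such \<open>l \<equiv> 1 (mod n!)\<close> has
  \<open>l (ln l - 1 - N ln n)\<close> very close to \<open>ln H\<close>, which gives the exponent \<open>m\<close> with a loss of at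
  most \<open>exp (N (N + 1) l ln n)\<close>.
\<close>

section \<open>Integers of imaginary quadratic fields\<close>

text \<open>This is the order Z[sqrt d], with \<open>d\<close> not assumed squarefree. It may miss
  integers of the field such as (1 + sqrt (-3)) / 2, but it is discrete and easy to compute
  in.\<close>

definition quad_lattice :: "int \<Rightarrow> complex set" where
  "quad_lattice d = {of_int a + of_int b * (\<i> * complex_of_real (sqrt (of_int (- d)))) | a b. True}"

lemma quad_lattice_of_int [simp]: "of_int a \<in> quad_lattice d"
  unfolding quad_lattice_def by (rule CollectI, rule exI[of _ a], rule exI[of _ 0]) simp

lemma quad_lattice_add:
  assumes "x \<in> quad_lattice d" "y \<in> quad_lattice d"
  shows "x + y \<in> quad_lattice d"
proof -
  obtain a b a' b' where
    "x = of_int a + of_int b * (\<i> * complex_of_real (sqrt (of_int (- d))))"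
    "y = of_int a' + of_int b' * (\<i> * complex_of_real (sqrt (of_int (- d))))"
    using assms unfolding quad_lattice_def by blast
  then have "x + y = of_int (a + a') + of_int (b + b') * (\<i> * complex_of_real (sqrt (of_int (- d))))"
    by (simp add: algebra_simps)
  then show ?thesis unfolding quad_lattice_def by blast
qed

lemma quad_lattice_mult:
  assumes d: "d < 0" and "x \<in> quad_lattice d" "y \<in> quad_lattice d"
  shows "x * y \<in> quad_lattice d"
proof -
  define w where "w = \<i> * complex_of_real (sqrt (of_int (- d)))"
  have "complex_of_real (sqrt (of_int (- d))) * complex_of_real (sqrt (of_int (- d))) = of_int (- d)"
    using d by (simp flip: of_real_mult)
  then have ww: "w * w = of_int d"
    by (simp add: w_def algebra_simps)
  obtain a b a' b' where "x = of_int a + of_int b * w" "y = of_int a' + of_int b' * w"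
    using assms unfolding quad_lattice_def w_def by blast
  then have "x * y = of_int a * of_int a' + of_int b * of_int b' * (w * w)
      + (of_int a * of_int b' + of_int b * of_int a') * w"
    by (simp add: algebra_simps)
  also have "\<dots> = of_int (a * a' + b * b' * d) + of_int (a * b' + b * a') * w"
    by (simp add: ww)
  finally show ?thesis unfolding quad_lattice_def w_def by blast
qed

lemma quad_lattice_power:
  "d < 0 \<Longrightarrow> x \<in> quad_lattice d \<Longrightarrow> x ^ k \<in> quad_lattice d"
  by (induction k) (use quad_lattice_of_int[of 1 d] in \<open>auto intro: quad_lattice_mult\<close>)

lemma quad_lattice_sum:
  "(\<And>i. i \<in> A \<Longrightarrow> f i \<in> quad_lattice d) \<Longrightarrow> sum f A \<in> quad_lattice d"
  by (induction A rule: infinite_finite_induct)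
     (use quad_lattice_of_int[of 0 d] in \<open>auto intro: quad_lattice_add\<close>)

text \<open>The squared modulus of a + b sqrt d is the integer a^2 + b^2 (-d), which is positive for
  a nonzero element.\<close>

lemma quad_lattice_norm_ge_1:
  assumes d: "d < 0" and z: "z \<in> quad_lattice d" "z \<noteq> 0"
  shows "cmod z \<ge> 1"
proof -
  obtain a b where ab: "z = of_int a + of_int b * (\<i> * complex_of_real (sqrt (of_int (- d))))"
    using z unfolding quad_lattice_def by blast
  have sq: "cmod z ^ 2 = of_int (a ^ 2 + b ^ 2 * (- d))"
    using d by (simp add: ab cmod_power2 power_mult_distrib)
  have "cmod z ^ 2 > 0" using z by simp
  then have "a ^ 2 + b ^ 2 * (- d) > 0"
    unfolding sq by (simp only: of_int_0_less_iff)
  then have "cmod z ^ 2 \<ge> 1"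
    unfolding sq by linarith
  then show ?thesis
    by (metis norm_ge_zero power_one power2_le_imp_le)
qed

text \<open>The powers of \<open>z\<close> have bounded denominators. This property replaces integrality because
  it is visibly inherited by sums, without resultants or finitely generated modules.\<close>

definition quad_int :: "int \<Rightarrow> complex \<Rightarrow> bool" where
  "quad_int d z \<longleftrightarrow> (\<exists>D :: int. D > 0 \<and> (\<forall>k. of_int D * z ^ k \<in> quad_lattice d))"

lemma quad_int_add:
  assumes d: "d < 0" and "quad_int d x" "quad_int d y"
  shows "quad_int d (x + y)"
proof -
  obtain D E :: int where D: "D > 0" "\<And>k. of_int D * x ^ k \<in> quad_lattice d"
    and E: "E > 0" "\<And>k. of_int E * y ^ k \<in> quad_lattice d"
    using assms unfolding quad_int_def by blast
  have "of_int (D * E) * (x + y) ^ k \<in> quad_lattice d" for k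
  proof -
    have "of_int (D * E) * (x + y) ^ k =
        (\<Sum>i\<le>k. of_int (int (k choose i)) * ((of_int D * x ^ i) * (of_int E * y ^ (k - i))))"
      by (simp add: binomial_ring sum_distrib_left mult_ac)
    also have "\<dots> \<in> quad_lattice d"
      by (intro quad_lattice_sum quad_lattice_mult d quad_lattice_of_int D E)
    finally show ?thesis .
  qed
  then show ?thesis
    unfolding quad_int_def using D E by (intro exI[of _ "D * E"]) simp
qed

lemma quad_int_of_int_mult:
  assumes d: "d < 0" and "quad_int d x"
  shows "quad_int d (of_int c * x)"
proof -
  obtain D :: int where D: "D > 0" "\<And>k. of_int D * x ^ k \<in> quad_lattice d"
    using assms unfolding quad_int_def by blast
  have "of_int D * (of_int c * x) ^ k \<in> quad_lattice d" for k
  proof -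
    have "of_int D * (of_int c * x) ^ k = of_int (c ^ k) * (of_int D * x ^ k)"
      by (simp add: power_mult_distrib)
    also have "\<dots> \<in> quad_lattice d"
      by (intro quad_lattice_mult d quad_lattice_of_int D)
    finally show ?thesis .
  qed
  then show ?thesis unfolding quad_int_def using D by blast
qed

lemma quad_int_0: "d < 0 \<Longrightarrow> quad_int d 0"
  unfolding quad_int_def
  by (intro exI[of _ 1]) (use quad_lattice_of_int[of 0 d] quad_lattice_of_int[of 1 d] in \<open>auto simp: power_0_left\<close>)

lemma quad_int_sum:
  "d < 0 \<Longrightarrow> (\<And>i. i \<in> A \<Longrightarrow> quad_int d (f i)) \<Longrightarrow> quad_int d (sum f A)"
  by (induction A rule: infinite_finite_induct) (auto intro: quad_int_0 quad_int_add)

text \<open>If \<open>0 < \<bar>z\<bar> < 1\<close>, the nonzero powers of \<open>z\<close> would tend to zero inside a discrete lattice.\<close>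

lemma quad_int_norm_ge_1:
  assumes d: "d < 0" and z: "quad_int d z" "z \<noteq> 0"
  shows "cmod z \<ge> 1"
proof (rule ccontr)
  assume "\<not> ?thesis"
  then have z1: "cmod z < 1" by simp
  obtain D :: int where D: "D > 0" "\<And>k. of_int D * z ^ k \<in> quad_lattice d"
    using z unfolding quad_int_def by blast
  have "\<exists>k. cmod z ^ k < 1 / real_of_int D"
    using D z1 by (intro real_arch_pow_inv) auto
  then obtain k where k: "cmod z ^ k < 1 / real_of_int D" by blast
  have "1 \<le> cmod (of_int D * z ^ k)"
    by (intro quad_lattice_norm_ge_1[OF d] D) (use D z in auto)
  also have "\<dots> = real_of_int D * cmod z ^ k"
    using D by (simp add: norm_mult norm_power)
  also have "\<dots> < 1"
    using k D by (simp add: field_simps)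
  finally show False by simp
qed

text \<open>If E clears the denominators of both coordinates of \<open>z\<close>, then E^n, with n
  the degree of the monic equation, works for every power of \<open>z\<close>: from z^n on, the
  equation expresses each power by lower ones with integer coefficients.\<close>

lemma ring_of_integers_iqf_quad_int:
  assumes d: "d < 0" and z: "z \<in> ring_of_integers_iqf d"
  shows "quad_int d z"
proof -
  define w where "w = \<i> * complex_of_real (sqrt (of_int (- d)))"
  obtain a b where ab: "z = of_rat a + of_rat b * w"
    using z unfolding ring_of_integers_iqf_def imag_quad_field_def w_def by blast
  obtain p :: "int poly" where p: "lead_coeff p = 1" "poly (map_poly of_int p) z = 0"
    using z unfolding ring_of_integers_iqf_def alg_int_def by blast
  obtain a1 a2 where a: "a = of_int a1 / of_int a2" "a2 > 0"
    by (metis quotient_of_div quotient_of_denom_pos surj_pair)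
  obtain b1 b2 where b: "b = of_int b1 / of_int b2" "b2 > 0"
    by (metis quotient_of_div quotient_of_denom_pos surj_pair)
  define E where "E = a2 * b2"
  have E0: "E > 0" using a b by (simp add: E_def)
  have "of_int E * z = of_int (a1 * b2) + of_int (b1 * a2) * w"
    using a(2) b(2) by (simp add: E_def ab a(1) b(1) of_rat_divide field_simps)
  then have Ez: "of_int E * z \<in> quad_lattice d"
    unfolding quad_lattice_def w_def by blast
  define n where "n = degree p"
  have "(\<Sum>i\<le>n. of_int (coeff p i) * z ^ i) = 0"
    using p(2) unfolding poly_altdef n_def by (simp add: coeff_map_poly degree_map_poly)
  then have "z ^ n + (\<Sum>i<n. of_int (coeff p i) * z ^ i) = 0"
    using p(1) by (simp add: n_def lessThan_Suc_atMost[symmetric] add.commute)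
  then have zn: "z ^ n = (\<Sum>i<n. of_int (- coeff p i) * z ^ i)"
    by (simp add: eq_neg_iff_add_eq_0 sum_negf)
  have "of_int (E ^ n) * z ^ k \<in> quad_lattice d" for k
  proof (induction k rule: less_induct)
    case (less k)
    show ?case
    proof (cases "k < n")
      case True
      then have "of_int (E ^ n) * z ^ k = of_int (E ^ (n - k)) * (of_int E * z) ^ k"
        by (simp add: power_mult_distrib flip: power_add mult.assoc)
      also have "\<dots> \<in> quad_lattice d"
        by (intro quad_lattice_mult d quad_lattice_of_int quad_lattice_power Ez)
      finally show ?thesis .
    next
      case False
      then have "z ^ k = z ^ (k - n) * z ^ n"
        by (simp flip: power_add)
      then have "of_int (E ^ n) * z ^ k =
          (\<Sum>i<n. of_int (- coeff p i) * (of_int (E ^ n) * z ^ (k - n + i)))"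
        by (simp add: zn sum_distrib_left power_add mult_ac)
      also have "\<dots> \<in> quad_lattice d"
        by (intro quad_lattice_sum quad_lattice_mult d quad_lattice_of_int less.IH)
           (use False in auto)
      finally show ?thesis .
    qed
  qed
  then show ?thesis
    unfolding quad_int_def using E0 by (intro exI[of _ "E ^ n"]) simp
qed

text \<open>A matrix that is diagonal and invertible modulo \<open>p\<close> is injective: a kernel vector would be
  divisible by \<open>p\<close> infinitely often.\<close>

lemma nonzero_sum_of_diagonal_mod_prime:
  fixes M :: "nat \<Rightarrow> nat \<Rightarrow> int" and a :: "nat \<Rightarrow> int"
  assumes p: "prime p"
    and diag: "\<And>k. k \<le> m \<Longrightarrow> \<not> p dvd M k k"
    and off: "\<And>k j. k \<le> m \<Longrightarrow> j \<le> m \<Longrightarrow> j \<noteq> k \<Longrightarrow> p dvd M k j"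
    and a: "\<exists>j\<le>m. a j \<noteq> 0"
  shows "\<exists>k\<le>m. (\<Sum>j\<le>m. M k j * a j) \<noteq> 0"
  using a
\<comment> \<open>The infinite descent becomes an induction on the sum of absolute values, which
  drops when a nonzero vector is divided by \<open>p\<close>.\<close>
proof (induction "\<Sum>j\<le>m. nat \<bar>a j\<bar>" arbitrary: a rule: less_induct)
  case less
  show ?case
  proof (rule ccontr)
    assume "\<not> ?thesis"
    then have zero: "(\<Sum>j\<le>m. M k j * a j) = 0" if "k \<le> m" for k
      using that by blast
    have dvd: "p dvd a k" if k: "k \<le> m" for k
    proof -
      have "(\<Sum>j\<le>m. M k j * a j) = M k k * a k + (\<Sum>j\<in>{..m} - {k}. M k j * a j)"
        using k by (simp add: sum.remove[of _ k])
      moreover have "p dvd (\<Sum>j\<in>{..m} - {k}. M k j * a j)"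
        by (intro dvd_sum dvd_mult2 off) (use k in auto)
      ultimately have "p dvd M k k * a k"
        using zero[OF k] by (metis dvd_0_right dvd_add_left_iff)
      then show ?thesis
        using diag[OF k] p by (simp add: prime_dvd_mult_iff)
    qed
    define b where "b = (\<lambda>j. a j div p)"
    have ab: "a j = p * b j" if "j \<le> m" for j
      using dvd[OF that] by (simp add: b_def)
    have p1: "p > 1" using p by (rule prime_gt_1_int)
    obtain i where i: "i \<le> m" "a i \<noteq> 0" using less.prems by blast
    have abs: "\<bar>a j\<bar> = p * \<bar>b j\<bar>" if "j \<le> m" for j
      using ab[OF that] p1 by (simp add: abs_mult)
    have "(\<Sum>j\<le>m. nat \<bar>b j\<bar>) < (\<Sum>j\<le>m. nat \<bar>a j\<bar>)"
    proof (rule sum_strict_mono_ex1)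
      show "\<forall>j\<in>{..m}. nat \<bar>b j\<bar> \<le> nat \<bar>a j\<bar>"
        using abs p1 by (auto intro!: nat_mono simp: mult_le_cancel_right1)
      have "b i \<noteq> 0" using i ab by auto
      then show "\<exists>j\<in>{..m}. nat \<bar>b j\<bar> < nat \<bar>a j\<bar>"
        using abs[OF i(1)] p1 i by (intro bexI[of _ i]) auto
    qed simp
    moreover have "\<exists>j\<le>m. b j \<noteq> 0"
      using i ab by (intro exI[of _ i]) auto
    ultimately obtain k where k: "k \<le> m" "(\<Sum>j\<le>m. M k j * b j) \<noteq> 0"
      using less.hyps by blast
    have "(\<Sum>j\<le>m. M k j * a j) = p * (\<Sum>j\<le>m. M k j * b j)"
      unfolding sum_distrib_left by (intro sum.cong) (auto simp: ab)
    then show False using zero[OF k(1)] k(2) p1 by simp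
  qed
qed

text \<open>A common denominator turns the vector into two integer vectors of coordinates. Since
  sqrt d is purely imaginary and nonzero, a vanishing combination vanishes in each coordinate, so
  the integer case applies to whichever vector is nonzero.\<close>

lemma quad_int_sum_nonzero:
  fixes M :: "nat \<Rightarrow> nat \<Rightarrow> int" and lam :: "nat \<Rightarrow> complex"
  assumes d: "d < 0" and p: "prime p"
    and diag: "\<And>k. k \<le> m \<Longrightarrow> \<not> p dvd M k k"
    and off: "\<And>k j. k \<le> m \<Longrightarrow> j \<le> m \<Longrightarrow> j \<noteq> k \<Longrightarrow> p dvd M k j"
    and lam: "\<And>j. j \<le> m \<Longrightarrow> quad_int d (lam j)" "\<exists>j\<le>m. lam j \<noteq> 0"
  shows "\<exists>k\<le>m. (\<Sum>j\<le>m. of_int (M k j) * lam j) \<noteq> 0"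
proof -
  define w where "w = \<i> * complex_of_real (sqrt (of_int (- d)))"
  have "\<exists>D :: int. D > 0 \<and> of_int D * lam j \<in> quad_lattice d" if "j \<le> m" for j
    using lam(1)[OF that] unfolding quad_int_def by (metis power_one_right)
  then obtain D :: "nat \<Rightarrow> int" where D: "\<And>j. j \<le> m \<Longrightarrow> D j > 0"
      "\<And>j. j \<le> m \<Longrightarrow> of_int (D j) * lam j \<in> quad_lattice d"
    by metis
  define E where "E = (\<Prod>j\<le>m. D j)"
  have E0: "E > 0" unfolding E_def by (intro prod_pos) (use D in auto)
  have "\<exists>a b. of_int E * lam j = of_int a + of_int b * w" if j: "j \<le> m" for j
  proof -
    have "of_int E * lam j = of_int (\<Prod>i\<in>{..m} - {j}. D i) * (of_int (D j) * lam j)"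
      using j unfolding E_def by (subst prod.remove[of _ j]) simp_all
    also have "\<dots> \<in> quad_lattice d"
      by (intro quad_lattice_mult d quad_lattice_of_int D j)
    finally show ?thesis unfolding quad_lattice_def w_def by blast
  qed
  then obtain a b where ab: "\<And>j. j \<le> m \<Longrightarrow> of_int E * lam j = of_int (a j) + of_int (b j) * w"
    by metis
  have zero: "(\<Sum>j\<le>m. M k j * a j) = 0 \<and> (\<Sum>j\<le>m. M k j * b j) = 0"
    if "(\<Sum>j\<le>m. of_int (M k j) * lam j) = 0" for k
  proof -
    have "0 = of_int E * (\<Sum>j\<le>m. of_int (M k j) * lam j)" using that by simp
    also have "\<dots> = (\<Sum>j\<le>m. of_int (M k j) * (of_int E * lam j))"
      by (simp add: sum_distrib_left mult_ac)
    also have "\<dots> = (\<Sum>j\<le>m. of_int (M k j) * (of_int (a j) + of_int (b j) * w))"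
      by (intro sum.cong) (auto simp: ab)
    also have "\<dots> = of_int (\<Sum>j\<le>m. M k j * a j) + of_int (\<Sum>j\<le>m. M k j * b j) * w"
      by (simp add: sum_distrib_left sum.distrib algebra_simps)
    finally have eq: "of_int (\<Sum>j\<le>m. M k j * a j) + of_int (\<Sum>j\<le>m. M k j * b j) * w = 0" by simp
    define S T where "S = (\<Sum>j\<le>m. M k j * a j)" and "T = (\<Sum>j\<le>m. M k j * b j)"
    have eq: "of_int S + of_int T * w = 0" using eq unfolding S_def T_def .
    have "Re (of_int S + of_int T * w) = 0" "Im (of_int S + of_int T * w) = 0"
      unfolding eq by simp_all
    then have "S = 0" "T = 0" using d by (simp_all add: w_def)
    then show ?thesis unfolding S_def T_def by blast
  qed
  obtain i where i: "i \<le> m" "lam i \<noteq> 0" using lam by blast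
  have "a i \<noteq> 0 \<or> b i \<noteq> 0" using ab[OF i(1)] i(2) E0 by auto
  then have "(\<exists>j\<le>m. a j \<noteq> 0) \<or> (\<exists>j\<le>m. b j \<noteq> 0)" using i by blast
  then have "\<exists>k\<le>m. (\<Sum>j\<le>m. M k j * a j) \<noteq> 0 \<or> (\<Sum>j\<le>m. M k j * b j) \<noteq> 0"
  proof
    assume "\<exists>j\<le>m. a j \<noteq> 0"
    then have "\<exists>k\<le>m. (\<Sum>j\<le>m. M k j * a j) \<noteq> 0"
      by (intro nonzero_sum_of_diagonal_mod_prime[where p = p]) (simp_all add: p diag off)
    then show ?thesis by blast
  next
    assume "\<exists>j\<le>m. b j \<noteq> 0"
    then have "\<exists>k\<le>m. (\<Sum>j\<le>m. M k j * b j) \<noteq> 0"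
      by (intro nonzero_sum_of_diagonal_mod_prime[where p = p]) (simp_all add: p diag off)
    then show ?thesis by blast
  qed
  then show ?thesis using zero by blast
qed

section \<open>Hermite's approximations\<close>

text \<open>Its value at x is the integral of exp (-t) p(x + t) over t >= 0. What matters is that
  exp (-x) times it has derivative -exp (-x) p(x).\<close>

definition deriv_sum :: "real poly \<Rightarrow> real poly" where
  "deriv_sum p = (\<Sum>i\<le>degree p. (pderiv ^^ i) p)"

lemma pderiv_deriv_sum: "pderiv (deriv_sum p) = deriv_sum p - p"
proof -
  have "pderiv (deriv_sum p) = (\<Sum>i\<le>degree p. (pderiv ^^ Suc i) p)"
    unfolding deriv_sum_def using higher_pderiv_sum[of 1] by simp
  moreover have "p + (\<Sum>i\<le>degree p. (pderiv ^^ Suc i) p) = (\<Sum>i\<le>Suc (degree p). (pderiv ^^ i) p)"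
    by (subst sum.atMost_Suc_shift) simp
  moreover have "(pderiv ^^ Suc (degree p)) p = 0"
    by (rule poly_eqI) (simp add: coeff_higher_pderiv coeff_eq_0 del: funpow.simps)
  ultimately show ?thesis
    unfolding deriv_sum_def by (simp del: funpow.simps add: algebra_simps)
qed

lemma pcompose_power: "(p ^ k) \<circ>\<^sub>p q = (p \<circ>\<^sub>p q) ^ k" for p q :: "'a::comm_ring_1 poly"
  by (induction k) (simp_all add: pcompose_mult pcompose_1)

text \<open>Taylor expansion at \<open>c\<close>. The factor i! in front of the shifted coefficients
  is the source of all divisibility by factorials.\<close>

lemma poly_higher_pderiv:
  "poly ((pderiv ^^ i) p) (c::real) = fact i * coeff (p \<circ>\<^sub>p [:c, 1:]) i"
proof -
  have shift: "(pderiv ^^ i) p \<circ>\<^sub>p [:c, 1:] = (pderiv ^^ i) (p \<circ>\<^sub>p [:c, 1:])"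
  proof (induction i)
    case (Suc i)
    then show ?case
      using pderiv_pcompose[of "(pderiv ^^ i) p" "[:c, 1:]"] by (simp add: pderiv_pCons)
  qed simp
  have "poly ((pderiv ^^ i) p) c = coeff ((pderiv ^^ i) p \<circ>\<^sub>p [:c, 1:]) 0"
    by (simp add: poly_pcompose flip: poly_0_coeff_0)
  then show ?thesis
    by (simp add: shift coeff_higher_pderiv pochhammer_fact)
qed

lemma poly_deriv_sum:
  assumes "degree p \<le> D"
  shows "poly (deriv_sum p) c = (\<Sum>i\<le>D. fact i * coeff (p \<circ>\<^sub>p [:c, 1:]) i)"
proof -
  have "poly (deriv_sum p) c = (\<Sum>i\<le>degree p. fact i * coeff (p \<circ>\<^sub>p [:c, 1:]) i)"
    unfolding deriv_sum_def by (simp add: poly_sum poly_higher_pderiv)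
  also have "\<dots> = (\<Sum>i\<le>D. fact i * coeff (p \<circ>\<^sub>p [:c, 1:]) i)"
    by (rule sum.mono_neutral_left) (use assms in \<open>auto intro!: coeff_eq_0 simp: degree_pcompose\<close>)
  finally show ?thesis .
qed

text \<open>The mean value theorem for exp (-x) times \<open>deriv_sum p\<close> replaces the
  integral in Hermite's identity.\<close>

lemma deriv_sum_exp_diff_le:
  assumes c: "0 \<le> c" and B: "\<And>x. 0 \<le> x \<Longrightarrow> x \<le> c \<Longrightarrow> \<bar>poly p x\<bar> \<le> B"
  shows "\<bar>exp c * poly (deriv_sum p) 0 - poly (deriv_sum p) c\<bar> \<le> B * c * exp c"
proof (cases "c = 0")
  case False
  define G where "G = (\<lambda>x. exp (- x) * poly (deriv_sum p) x)"
  have der: "(G has_real_derivative - (exp (- x) * poly p x)) (at x)" for x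
    unfolding G_def
    by (auto intro!: derivative_eq_intros simp: pderiv_deriv_sum algebra_simps)
  obtain z where z: "0 < z" "z < c" "G c - G 0 = (c - 0) * - (exp (- z) * poly p z)"
    using MVT2[of 0 c G "\<lambda>x. - (exp (- x) * poly p x)"] c False der by fastforce
  have "\<bar>G c - G 0\<bar> = c * (exp (- z) * \<bar>poly p z\<bar>)"
    using c by (simp add: z(3) abs_mult)
  also have "\<dots> \<le> c * (1 * B)"
    by (intro mult_left_mono mult_mono) (use z c B[of z] in auto)
  finally have G: "\<bar>G c - G 0\<bar> \<le> B * c" by (simp add: mult.commute)
  have "exp c * poly (deriv_sum p) 0 - poly (deriv_sum p) c = exp c * (G 0 - G c)"
    by (simp add: G_def algebra_simps exp_minus)
  then have "\<bar>exp c * poly (deriv_sum p) 0 - poly (deriv_sum p) c\<bar> = exp c * \<bar>G c - G 0\<bar>"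
    by (simp add: abs_mult abs_minus_commute)
  also have "\<dots> \<le> exp c * (B * c)"
    using G by simp
  finally show ?thesis by (simp add: mult_ac)
qed simp

text \<open>With the root shifted to 0, coefficients below index \<open>r\<close> vanish, the one at
  \<open>r\<close> contributes r! g(c), and the later ones come with multiples of (r + 1)!.\<close>

lemma poly_deriv_sum_at_root:
  fixes g :: "real poly"
  assumes g: "\<And>i. coeff (g \<circ>\<^sub>p [:c, 1:]) i \<in> \<int>"
  shows "\<exists>z::int. poly (deriv_sum ([:- c, 1:] ^ r * g)) c = fact r * (poly g c + real (Suc r) * of_int z)"
proof -
  define h where "h = g \<circ>\<^sub>p [:c, 1:]"
  define D where "D = degree g"
  have comp: "([:- c, 1:] ^ r * g) \<circ>\<^sub>p [:c, 1:] = monom 1 r * h"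
    by (simp add: pcompose_mult pcompose_power pcompose_pCons h_def monom_altdef)
  have "degree ([:- c, 1:] ^ r * g) \<le> r + D"
    using degree_mult_le[of "[:- c, 1:] ^ r" g] by (simp add: D_def degree_linear_power)
  then have "poly (deriv_sum ([:- c, 1:] ^ r * g)) c = (\<Sum>i\<le>r + D. fact i * coeff (monom 1 r * h) i)"
    by (subst poly_deriv_sum) (simp_all add: comp)
  also have "\<dots> = (\<Sum>i\<in>{r..r + D}. fact i * coeff (monom 1 r * h) i)"
    by (rule sum.mono_neutral_right) (auto simp: coeff_monom_mult)
  also have "\<dots> = (\<Sum>i\<in>{0..D}. fact (i + r) * coeff h i)"
    using sum.shift_bounds_cl_nat_ivl[of "\<lambda>i. fact i * coeff (monom 1 r * h) i" 0 r D]
    by (simp add: coeff_monom_mult add.commute)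
  also have "\<dots> = fact r * coeff h 0 + (\<Sum>i\<in>{1..D}. fact (i + r) * coeff h i)"
    by (simp add: sum.atLeast_Suc_atMost)
  also have "coeff h 0 = poly g c"
    by (simp add: h_def poly_pcompose flip: poly_0_coeff_0)
  finally have eq: "poly (deriv_sum ([:- c, 1:] ^ r * g)) c =
      fact r * poly g c + (\<Sum>i\<in>{1..D}. fact (i + r) * coeff h i)" .
  have "\<exists>z::int. fact (i + r) * coeff h i = fact r * (real (Suc r) * of_int z)" if i: "i \<in> {1..D}" for i
  proof -
    have "fact (Suc r) dvd (fact (i + r) :: nat)"
      using i by (intro fact_dvd) auto
    then obtain q :: nat where "fact (i + r) = fact (Suc r) * q" by (elim dvdE)
    then have q: "(fact (i + r) :: real) = fact (Suc r) * real q"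
      by (metis of_nat_fact of_nat_mult)
    obtain z :: int where z: "coeff h i = of_int z"
      using g[of i] by (auto simp: h_def elim: Ints_cases)
    show ?thesis
      by (rule exI[of _ "int q * z"]) (simp add: q z mult_ac)
  qed
  then obtain zf :: "nat \<Rightarrow> int" where
    zf: "\<And>i. i \<in> {1..D} \<Longrightarrow> fact (i + r) * coeff h i = fact r * (real (Suc r) * of_int (zf i))"
    by metis
  have "(\<Sum>i\<in>{1..D}. fact (i + r) * coeff h i) = (\<Sum>i\<in>{1..D}. fact r * (real (Suc r) * of_int (zf i)))"
    by (intro sum.cong refl zf)
  also have "\<dots> = fact r * (real (Suc r) * of_int (\<Sum>i\<in>{1..D}. zf i))"
    by (simp only: sum_distrib_left of_int_sum)
  finally show ?thesis
    unfolding eq by (intro exI[of _ "\<Sum>i\<in>{1..D}. zf i"]) (simp add: algebra_simps)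
qed

section \<open>Coefficientwise majorants of polynomials\<close>

definition dominated :: "real poly \<Rightarrow> real poly \<Rightarrow> bool" where
  "dominated p q \<longleftrightarrow> (\<forall>i. \<bar>coeff p i\<bar> \<le> coeff q i)"

text \<open>Domination forces the majorant to have nonnegative coefficients, so the convolutions can
  be compared term by term.\<close>

lemma dominated_mult:
  assumes "dominated p q" "dominated p' q'"
  shows "dominated (p * p') (q * q')"
  unfolding dominated_def
proof
  fix i
  have "\<bar>coeff (p * p') i\<bar> \<le> (\<Sum>j\<le>i. \<bar>coeff p j * coeff p' (i - j)\<bar>)"
    unfolding coeff_mult by (rule sum_abs)
  also have "\<dots> \<le> (\<Sum>j\<le>i. coeff q j * coeff q' (i - j))"
  proof (intro sum_mono)
    fix j
    have "0 \<le> coeff q j"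
      using assms(1) unfolding dominated_def by (meson abs_ge_zero order_trans)
    then show "\<bar>coeff p j * coeff p' (i - j)\<bar> \<le> coeff q j * coeff q' (i - j)"
      unfolding abs_mult using assms by (intro mult_mono) (auto simp: dominated_def)
  qed
  finally show "\<bar>coeff (p * p') i\<bar> \<le> coeff (q * q') i" by (simp add: coeff_mult)
qed

lemma dominated_1: "dominated 1 1"
  by (simp add: dominated_def)

lemma dominated_power: "dominated p q \<Longrightarrow> dominated (p ^ k) (q ^ k)"
  by (induction k) (auto intro: dominated_mult dominated_1)

lemma dominated_prod:
  "(\<And>j. j \<in> A \<Longrightarrow> dominated (f j) (g j)) \<Longrightarrow> dominated (prod f A) (prod g A)"
  by (induction A rule: infinite_finite_induct) (auto intro: dominated_mult dominated_1)

section \<open>Size and divisibility for products of powers of X - \<open>\<beta> j\<close>\<close>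

definition hermite_poly :: "nat \<Rightarrow> (nat \<Rightarrow> nat) \<Rightarrow> (nat \<Rightarrow> nat) \<Rightarrow> real poly" where
  "hermite_poly m \<beta> e = (\<Prod>j\<le>m. [:- real (\<beta> j), 1:] ^ e j)"

lemma degree_hermite_poly: "degree (hermite_poly m \<beta> e) = (\<Sum>j\<le>m. e j)"
  unfolding hermite_poly_def
  by (subst degree_prod_sum_eq) (auto simp: degree_linear_power)

lemma poly_hermite_poly: "poly (hermite_poly m \<beta> e) x = (\<Prod>j\<le>m. (x - real (\<beta> j)) ^ e j)"
  by (simp add: hermite_poly_def poly_prod)

lemma abs_poly_hermite_poly_le:
  assumes "\<And>j. j \<le> m \<Longrightarrow> \<beta> j \<le> n" "0 \<le> x" "x \<le> real n"
  shows "\<bar>poly (hermite_poly m \<beta> e) x\<bar> \<le> real n ^ (\<Sum>j\<le>m. e j)"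
proof -
  have "\<bar>poly (hermite_poly m \<beta> e) x\<bar> = (\<Prod>j\<le>m. \<bar>x - real (\<beta> j)\<bar> ^ e j)"
    by (simp add: poly_hermite_poly abs_prod power_abs)
  also have "\<dots> \<le> (\<Prod>j\<le>m. real n ^ e j)"
  proof (intro prod_mono conjI power_mono)
    fix j assume "j \<in> {..m}"
    then have "real (\<beta> j) \<le> real n" using assms(1) by simp
    then show "\<bar>x - real (\<beta> j)\<bar> \<le> real n" using assms(2,3) by linarith
  qed simp_all
  finally show ?thesis by (simp add: power_sum)
qed

text \<open>The coefficients are dominated by those of \<open>(X + n)\<^sup>D\<close>, and
  \<open>\<Sum>i\<le>D. i! (D choose i) n\<^sup>D\<^sup>-\<^sup>i\<close> is \<open>D!\<close> times a partial sum of the series of \<open>exp n\<close>.\<close>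

lemma abs_deriv_sum_hermite_poly_0_le:
  assumes "\<And>j. j \<le> m \<Longrightarrow> \<beta> j \<le> n"
  shows "\<bar>poly (deriv_sum (hermite_poly m \<beta> e)) 0\<bar> \<le> fact (\<Sum>j\<le>m. e j) * exp (real n)"
proof -
  define D where "D = (\<Sum>j\<le>m. e j)"
  have "dominated (hermite_poly m \<beta> e) (\<Prod>j\<le>m. [:real n, 1:] ^ e j)"
    unfolding hermite_poly_def
    by (intro dominated_prod dominated_power)
       (use assms in \<open>auto simp: dominated_def coeff_pCons split: nat.splits\<close>)
  then have dom: "dominated (hermite_poly m \<beta> e) ([:real n, 1:] ^ D)"
    by (simp add: D_def power_sum)
  have "\<bar>poly (deriv_sum (hermite_poly m \<beta> e)) 0\<bar> = \<bar>\<Sum>i\<le>D. fact i * coeff (hermite_poly m \<beta> e) i\<bar>"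
    by (subst poly_deriv_sum[of _ D]) (simp_all add: degree_hermite_poly D_def)
  also have "\<dots> \<le> (\<Sum>i\<le>D. \<bar>fact i * coeff (hermite_poly m \<beta> e) i\<bar>)"
    by (rule sum_abs)
  also have "\<dots> \<le> (\<Sum>i\<le>D. fact i * coeff ([:real n, 1:] ^ D) i)"
    by (intro sum_mono) (use dom in \<open>auto simp: abs_mult dominated_def\<close>)
  also have "\<dots> = (\<Sum>i\<le>D. fact D * (real n ^ (D - i) / fact (D - i)))"
    by (intro sum.cong) (auto simp: coeff_linear_poly_power binomial_fact)
  also have "\<dots> = fact D * (\<Sum>i\<le>D. real n ^ (D - i) / fact (D - i))"
    by (simp add: sum_distrib_left)
  also have "(\<Sum>i\<le>D. real n ^ (D - i) / fact (D - i)) = (\<Sum>i\<le>D. real n ^ i / fact i)"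
    by (rule sum.reindex_bij_witness[of _ "\<lambda>i. D - i" "\<lambda>i. D - i"]) auto
  also have "\<dots> \<le> exp (real n)"
  proof -
    have "(\<lambda>i. real n ^ i / fact i) sums exp (real n)"
      using exp_converges[of "real n"] by (simp add: divide_inverse mult.commute)
    then show ?thesis
      using sum_le_suminf[of "\<lambda>i. real n ^ i / fact i" "{..D}"] by (simp add: sums_iff)
  qed
  finally show ?thesis by (simp add: D_def mult_left_mono)
qed

text \<open>Shifted to node \<open>k\<close>, the other factors have integer coefficients because
  differences of nodes are integers, so the expansion at a root applies. Modulo
  \<open>Suc (e k)\<close> only the product of differences remains.\<close>

lemma deriv_sum_hermite_poly_at_node:
  assumes k: "k \<le> m"
  shows "\<exists>z::int. poly (deriv_sum (hermite_poly m \<beta> e)) (real (\<beta> k)) =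
    fact (e k) * of_int ((\<Prod>j\<in>{..m} - {k}. (int (\<beta> k) - int (\<beta> j)) ^ e j) + int (Suc (e k)) * z)"
proof -
  define g where "g = (\<Prod>j\<in>{..m} - {k}. [:- real (\<beta> j), 1:] ^ e j)"
  have split: "hermite_poly m \<beta> e = [:- real (\<beta> k), 1:] ^ e k * g"
    unfolding hermite_poly_def g_def using k by (subst prod.remove[of _ k]) auto
  have int_mult: "\<forall>i. coeff (p * q) i \<in> \<int>" if "\<forall>i. coeff p i \<in> \<int>" "\<forall>i. coeff q i \<in> \<int>"
    for p q :: "real poly"
    using that by (auto simp: coeff_mult intro: Ints_mult)
  have int_power: "\<forall>i. coeff (p ^ t) i \<in> \<int>" if "\<forall>i. coeff p i \<in> \<int>" for p :: "real poly" and t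
    by (induction t) (use that int_mult in auto)
  have int_prod: "\<forall>i. coeff (\<Prod>j\<in>A. f j) i \<in> \<int>" if "\<And>j i. coeff (f j) i \<in> \<int>"
    for f :: "nat \<Rightarrow> real poly" and A
    by (induction A rule: infinite_finite_induct) (use that int_mult in auto)
  have "g \<circ>\<^sub>p [:real (\<beta> k), 1:] = (\<Prod>j\<in>{..m} - {k}. [:real (\<beta> k) - real (\<beta> j), 1:] ^ e j)"
    by (simp add: g_def pcompose_prod pcompose_power pcompose_pCons)
  also have "\<forall>i. coeff \<dots> i \<in> \<int>"
    by (intro int_prod int_power[rule_format])
       (auto simp: coeff_pCons split: nat.splits intro!: Ints_diff)
  finally obtain z :: int where z: "poly (deriv_sum (hermite_poly m \<beta> e)) (real (\<beta> k)) =
      fact (e k) * (poly g (real (\<beta> k)) + real (Suc (e k)) * of_int z)"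
    using poly_deriv_sum_at_root[of g "real (\<beta> k)" "e k"] unfolding split by blast
  have "poly g (real (\<beta> k)) = of_int (\<Prod>j\<in>{..m} - {k}. (int (\<beta> k) - int (\<beta> j)) ^ e j)"
    by (simp add: g_def poly_prod)
  then show ?thesis
    unfolding z by (intro exI[of _ z]) simp
qed

section \<open>The lower bound in terms of the order\<close>

text \<open>Which \<open>k\<close> gives a nonzero combination depends on \<open>lam\<close>, so
  every estimate for \<open>F k\<close> is made uniform in \<open>k\<close>.\<close>

lemma exp_linear_form_lower_bound:
  fixes lam :: "nat \<Rightarrow> complex"
  assumes d: "d < 0" and \<beta>: "\<And>j. j \<le> m \<Longrightarrow> \<beta> j \<le> n" "\<beta> 0 = 0" "inj_on \<beta> {..m}"
    and l: "l \<ge> 2" "coprime l (fact n)"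
    and lam: "\<And>j. j \<le> m \<Longrightarrow> quad_int d (lam j)" "\<exists>j\<le>m. lam j \<noteq> 0"
    and H: "\<And>j. j \<in> {1..m} \<Longrightarrow> cmod (lam j) \<le> H"
    and small: "real m * H * real n ^ (Suc m * l) * exp (real n) \<le> fact (l - 1) / 2"
  shows "fact (l - 1) / 2 \<le>
    fact (Suc m * l - 1) * exp (real n) * cmod (\<Sum>j\<le>m. lam j * complex_of_real (exp (real (\<beta> j))))"
proof -
  define \<Lambda> where "\<Lambda> = (\<Sum>j\<le>m. lam j * complex_of_real (exp (real (\<beta> j))))"
  \<comment> \<open>Lowering the order at node \<open>k\<close> alone makes (l - 1)! the natural
    factor there, while every other node yields l!.\<close>
  define e where "e = (\<lambda>k j :: nat. if j = k then l - 1 else l)"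
  define F where "F = (\<lambda>k. deriv_sum (hermite_poly m \<beta> (e k)))"
  have sum_e: "(\<Sum>j\<le>m. e k j) = Suc m * l - 1" if "k \<le> m" for k
  proof -
    have "(\<Sum>j\<le>m. e k j) = (l - 1) + (\<Sum>j\<in>{..m} - {k}. e k j)"
      using that by (subst sum.remove[of _ k]) (auto simp: e_def)
    also have "(\<Sum>j\<in>{..m} - {k}. e k j) = (\<Sum>j\<in>{..m} - {k}. l)"
      by (intro sum.cong) (auto simp: e_def)
    also have "\<dots> = m * l" using that by simp
    finally show ?thesis using l(1) by simp
  qed
  obtain p :: nat where p: "prime p" "p dvd l"
    using l(1) prime_factor_nat[of l] by auto
  have p_int: "prime (int p)" using p by simp
  have pl: "int p dvd int l" using p by simp
  \<comment> \<open>Consequently \<open>p\<close> divides no integer between 1 and \<open>n\<close>,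
    in particular no difference of two distinct nodes.\<close>
  have p_fact: "\<not> p dvd fact n"
    using p l(2) by (meson coprime_common_divisor not_prime_unit)
  have "\<exists>M::int. poly (F k) (real (\<beta> j)) = fact (l - 1) * of_int M \<and> (int p dvd M \<longleftrightarrow> j \<noteq> k)"
    if k: "k \<le> m" and j: "j \<le> m" for k j
  proof -
    obtain z where z: "poly (F k) (real (\<beta> j)) = fact (e k j) *
        of_int ((\<Prod>i\<in>{..m} - {j}. (int (\<beta> j) - int (\<beta> i)) ^ e k i) + int (Suc (e k j)) * z)"
      using deriv_sum_hermite_poly_at_node[OF j] unfolding F_def by blast
    show ?thesis
    proof (cases "j = k")
      case False
      define Q where "Q = (\<Prod>i\<in>{..m} - {j}. (int (\<beta> j) - int (\<beta> i)) ^ e k i) + int (Suc (e k j)) * z"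
      \<comment> \<open>Off the diagonal, l! exceeds (l - 1)! by the factor \<open>l\<close>, a
        multiple of \<open>p\<close>.\<close>
      have "(fact l :: real) = real l * fact (l - 1)"
        using l(1) by (simp add: fact_reduce)
      then have "poly (F k) (real (\<beta> j)) = fact (l - 1) * of_int (int l * Q)"
        using z False unfolding Q_def[symmetric] by (simp add: e_def)
      then show ?thesis using False pl by (intro exI[of _ "int l * Q"]) simp
    next
      case True
      define P where "P = (\<Prod>i\<in>{..m} - {j}. (int (\<beta> j) - int (\<beta> i)) ^ e k i)"
      have "\<not> int p dvd int (\<beta> j) - int (\<beta> i)" if i: "i \<in> {..m} - {j}" for i
      proof
        assume dv: "int p dvd int (\<beta> j) - int (\<beta> i)"
        define q where "q = nat \<bar>int (\<beta> j) - int (\<beta> i)\<bar>"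
        have "\<beta> j \<noteq> \<beta> i" using \<beta>(3) i j by (auto simp: inj_on_def)
        then have "0 < q" "q \<le> n" using \<beta>(1)[of i] \<beta>(1)[OF j] i by (auto simp: q_def)
        then have "q dvd fact n" by (intro dvd_fact) auto
        moreover have "int p dvd int q" using dv by (simp add: q_def)
        then have "p dvd q" by (simp only: int_dvd_int_iff)
        ultimately show False using p_fact dvd_trans by blast
      qed
      then have "\<not> int p dvd (int (\<beta> j) - int (\<beta> i)) ^ e k i" if "i \<in> {..m} - {j}" for i
        using that prime_dvd_power[OF p_int] by blast
      then have "\<not> int p dvd P"
        unfolding P_def using p_int by (subst prime_dvd_prod_iff) auto
      \<comment> \<open>On the diagonal the order is l - 1, so the modulus is \<open>l\<close>
        itself and the unknown integer \<open>z\<close> disappears modulo \<open>p\<close>.\<close>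
      moreover have "int (Suc (e k j)) = int l" using True l(1) by (simp add: e_def)
      ultimately have "\<not> int p dvd P + int (Suc (e k j)) * z"
        using pl by (metis dvd_add_left_iff dvd_mult2)
      then show ?thesis
        using z True by (intro exI[of _ "P + int (Suc (e k j)) * z"]) (simp add: e_def P_def)
    qed
  qed
  then obtain M :: "nat \<Rightarrow> nat \<Rightarrow> int" where
    M: "\<And>k j. k \<le> m \<Longrightarrow> j \<le> m \<Longrightarrow> poly (F k) (real (\<beta> j)) = fact (l - 1) * of_int (M k j)"
    and M_dvd: "\<And>k j. k \<le> m \<Longrightarrow> j \<le> m \<Longrightarrow> int p dvd M k j \<longleftrightarrow> j \<noteq> k"
    by metis
  obtain k where k: "k \<le> m" and nz: "(\<Sum>j\<le>m. of_int (M k j) * lam j) \<noteq> 0"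
    using quad_int_sum_nonzero[OF d p_int, of m M lam] M_dvd lam by auto
  have "1 \<le> cmod (\<Sum>j\<le>m. of_int (M k j) * lam j)"
    by (intro quad_int_norm_ge_1[OF d] quad_int_sum quad_int_of_int_mult d lam nz) auto
  then have "fact (l - 1) \<le> fact (l - 1) * cmod (\<Sum>j\<le>m. of_int (M k j) * lam j)"
    by simp
  also have "\<dots> = cmod (of_real (fact (l - 1)) * (\<Sum>j\<le>m. of_int (M k j) * lam j))"
    by (simp only: norm_mult norm_of_real) simp
  also have "of_real (fact (l - 1)) * (\<Sum>j\<le>m. of_int (M k j) * lam j) =
      (\<Sum>j\<le>m. lam j * of_real (poly (F k) (real (\<beta> j))))"
    unfolding sum_distrib_left by (intro sum.cong) (auto simp: M k)
  \<comment> \<open>Each value at a node is written as exp (\<open>\<beta> j\<close>) F(0) minus the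
    error of Hermite's approximation.\<close>
  also have "\<dots> = of_real (poly (F k) 0) * \<Lambda> -
      (\<Sum>j\<le>m. lam j * of_real (exp (real (\<beta> j)) * poly (F k) 0 - poly (F k) (real (\<beta> j))))"
    unfolding \<Lambda>_def sum_distrib_left sum_subtractf[symmetric]
    by (intro sum.cong) (auto simp: algebra_simps)
  also have "cmod \<dots> \<le> \<bar>poly (F k) 0\<bar> * cmod \<Lambda> +
      cmod (\<Sum>j\<le>m. lam j * of_real (exp (real (\<beta> j)) * poly (F k) 0 - poly (F k) (real (\<beta> j))))"
    by (rule order_trans[OF norm_triangle_ineq4]) (simp add: norm_mult)
  also have "\<dots> \<le> fact (Suc m * l - 1) * exp (real n) * cmod \<Lambda> + fact (l - 1) / 2"
  proof (rule add_mono)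
    show "\<bar>poly (F k) 0\<bar> * cmod \<Lambda> \<le> fact (Suc m * l - 1) * exp (real n) * cmod \<Lambda>"
      using abs_deriv_sum_hermite_poly_0_le[of m \<beta> n "e k"] \<beta>(1) sum_e[OF k]
      by (intro mult_right_mono) (auto simp: F_def)
    define B where "B = real n ^ (Suc m * l - 1)"
    have r: "\<bar>exp (real (\<beta> j)) * poly (F k) 0 - poly (F k) (real (\<beta> j))\<bar> \<le> B * real n * exp (real n)"
      if j: "j \<le> m" for j
    proof -
      have "\<bar>exp (real (\<beta> j)) * poly (F k) 0 - poly (F k) (real (\<beta> j))\<bar> \<le>
          B * real (\<beta> j) * exp (real (\<beta> j))"
        unfolding F_def
      proof (rule deriv_sum_exp_diff_le)
        fix x assume x: "0 \<le> x" "x \<le> real (\<beta> j)"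
        then have "x \<le> real n" using \<beta>(1)[OF j] by linarith
        then show "\<bar>poly (hermite_poly m \<beta> (e k)) x\<bar> \<le> B"
          using abs_poly_hermite_poly_le[of m \<beta> n x "e k"] \<beta>(1) x sum_e[OF k] by (simp add: B_def)
      qed simp
      also have "\<dots> \<le> B * real n * exp (real n)"
        using \<beta>(1)[OF j] by (intro mult_mono) (auto simp: B_def)
      finally show ?thesis .
    qed
    \<comment> \<open>The error at node 0 is exactly zero because \<open>\<beta> 0 = 0\<close>;
      hence no bound on \<open>lam 0\<close> enters.\<close>
    have "(\<Sum>j\<le>m. lam j * of_real (exp (real (\<beta> j)) * poly (F k) 0 - poly (F k) (real (\<beta> j)))) =
        (\<Sum>j\<in>{1..m}. lam j * of_real (exp (real (\<beta> j)) * poly (F k) 0 - poly (F k) (real (\<beta> j))))"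
      by (rule sum.mono_neutral_right) (auto simp: \<beta>(2) Suc_le_eq)
    also have "cmod \<dots> \<le> (\<Sum>j\<in>{1..m}. H * (B * real n * exp (real n)))"
    proof (rule sum_norm_le)
      fix j assume j: "j \<in> {1..m}"
      have "0 \<le> H" using H[OF j] by (meson norm_ge_zero order_trans)
      then show "cmod (lam j * of_real (exp (real (\<beta> j)) * poly (F k) 0 - poly (F k) (real (\<beta> j))))
          \<le> H * (B * real n * exp (real n))"
        unfolding norm_mult norm_of_real using H[OF j] r[of j] j by (intro mult_mono) auto
    qed
    also have "\<dots> = real m * H * (B * real n) * exp (real n)" by simp
    \<comment> \<open>The length of the interval, at most \<open>n\<close>, supplies the power of
      \<open>n\<close> missing from the degree \<open>Suc m * l - 1\<close>.\<close>
    also have "B * real n = real n ^ (Suc m * l)"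
      using l(1) by (simp add: B_def flip: power_Suc2)
    also have "real m * H * real n ^ (Suc m * l) * exp (real n) \<le> fact (l - 1) / 2"
      by (rule small)
    finally show "cmod (\<Sum>j\<le>m. lam j * of_real (exp (real (\<beta> j)) * poly (F k) 0 - poly (F k) (real (\<beta> j))))
        \<le> fact (l - 1) / 2" .
  qed
  finally show ?thesis unfolding \<Lambda>_def by linarith
qed

section \<open>Explicit bounds for factorials\<close>

lemma fact_add_le: "(fact (a + b) :: real) \<le> fact a * real (a + b) ^ b"
proof (induction b)
  case (Suc b)
  have "(fact (a + Suc b) :: real) = real (a + Suc b) * fact (a + b)" by simp
  also have "\<dots> \<le> real (a + Suc b) * (fact a * real (a + b) ^ b)"
    by (intro mult_left_mono Suc.IH) simp
  also have "\<dots> \<le> real (a + Suc b) * (fact a * real (a + Suc b) ^ b)"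
    by (intro mult_left_mono power_mono) auto
  finally show ?case by (simp add: mult_ac)
qed simp

text \<open>The multinomial coefficient (N l)! / (l!)^N is at most N^(N l). Each induction step adds
  N factors, none larger than N (l + 1).\<close>

lemma fact_mult_le: "(fact (N * l) :: real) \<le> real N ^ (N * l) * fact l ^ N"
proof (induction l)
  case (Suc l)
  have "(fact (N * Suc l) :: real) \<le> fact (N * l) * real (N * l + N) ^ N"
    using fact_add_le[of "N * l" N] by (simp add: add.commute)
  also have "real (N * l + N) = real N * real (Suc l)" by (simp add: algebra_simps)
  also have "fact (N * l) * (real N * real (Suc l)) ^ N \<le>
      (real N ^ (N * l) * fact l ^ N) * (real N * real (Suc l)) ^ N"
    by (intro mult_right_mono Suc.IH) simp
  also have "\<dots> = real N ^ (N * Suc l) * fact (Suc l) ^ N"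
    by (simp add: power_mult_distrib power_add mult_ac del: of_nat_Suc)
  finally show ?case .
qed simp

text \<open>A single term of the exponential series gives l^l / l! <= exp l.\<close>

lemma ln_fact_ge: "real l * ln (real l) - real l \<le> ln (fact l)"
proof (cases "l = 0")
  case False
  have "(\<lambda>i. real l ^ i / fact i) sums exp (real l)"
    using exp_converges[of "real l"] by (simp add: divide_inverse mult.commute)
  then have "real l ^ l / fact l \<le> exp (real l)"
    using sum_le_suminf[of "\<lambda>i. real l ^ i / fact i" "{l}"] by (simp add: sums_iff)
  then have "ln (real l ^ l / fact l) \<le> ln (exp (real l))"
    using False by (subst ln_le_cancel_iff) auto
  then show ?thesis using False by (simp add: ln_div ln_realpow)
qed simp

text \<open>The induction step amounts to (l + 1) ln (1 + 1 / l) >= 1.\<close>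

lemma ln_fact_le:
  "l \<ge> 1 \<Longrightarrow> ln (fact l) \<le> real l * ln (real l) - real l + 1 + ln (real l)"
proof (induction l rule: nat_induct_at_least)
  case (Suc l)
  have "ln (real l / real (Suc l)) \<le> real l / real (Suc l) - 1"
    using Suc.hyps by (intro ln_le_minus_one) auto
  then have "ln (real l) - ln (real (Suc l)) \<le> - 1 / real (Suc l)"
    using Suc.hyps by (simp add: ln_div divide_simps)
  then have "real (Suc l) * (ln (real l) - ln (real (Suc l))) \<le> real (Suc l) * (- 1 / real (Suc l))"
    by (intro mult_left_mono) auto
  then have "(real l + 1) * ln (real l) + 1 \<le> (real l + 1) * ln (real l + 1)"
    by (simp add: algebra_simps)
  moreover have "ln (fact (Suc l)) = ln (real l + 1) + ln (fact l)"
    by (simp add: ln_mult add.commute)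
  ultimately show ?case using Suc.IH by (simp add: algebra_simps)
qed simp

section \<open>Choice of the order\<close>

lemma two_mult_le_exp: "2 * x \<le> exp x" for x :: real
proof (cases "x \<ge> 0")
  case True
  have "2 * x \<le> (1 + x / 2) ^ 2"
    using zero_le_power2[of "1 - x / 2"] by (simp add: power2_eq_square algebra_simps)
  also have "\<dots> \<le> exp (x / 2) ^ 2"
    using True by (intro power_mono) auto
  also have "\<dots> = exp x" by (simp flip: exp_of_nat_mult)
  finally show ?thesis .
next
  case False
  then show ?thesis using exp_ge_zero[of x] by linarith
qed

lemma ln_le_half: "x > 0 \<Longrightarrow> ln x \<le> x / 2" for x :: real
  using two_mult_le_exp[of "ln x"] by simp

lemma ln_ge_5_4: "n \<ge> 4 \<Longrightarrow> 5 / 4 \<le> ln (real n)"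
proof -
  assume "n \<ge> 4"
  have "(5 / 4 :: real) \<le> 2 * ln 2" using ln2_ge_two_thirds by simp
  also have "\<dots> = ln 4" using ln_realpow[of 2 2] by simp
  also have "\<dots> \<le> ln (real n)" using \<open>n \<ge> 4\<close> by simp
  finally show ?thesis .
qed

text \<open>A rational bound for ln 11, obtained from e^47 <= 2.72^47 <= 11^20.\<close>

lemma ln_ge_47_20:
  assumes "n \<ge> 11" shows "47 / 20 \<le> ln (real n)"
proof -
  have "exp (47 :: real) = exp 1 ^ 47" by (simp flip: exp_of_nat_mult)
  also have "\<dots> \<le> (272 / 100) ^ 47"
    using e_less_272 by (intro power_mono) auto
  also have "\<dots> \<le> 11 ^ 20" by (simp add: power_divide)
  finally have "ln (exp (47 :: real)) \<le> ln (11 ^ 20)"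
    by (subst ln_le_cancel_iff) auto
  also have "ln (11 ^ 20 :: real) = 20 * ln 11" by (subst ln_realpow) auto
  finally have "47 / 20 \<le> ln (11 :: real)" by simp
  also have "\<dots> \<le> ln (real n)" using assms by simp
  finally show ?thesis .
qed

text \<open>The constant is 4! / 4^4; each further factor of n! is at most n.\<close>

lemma fact_le_power_self:
  assumes "n \<ge> 4" shows "(fact n :: real) \<le> 3 / 32 * real n ^ n"
proof -
  obtain b where b: "n = 4 + b" using assms le_Suc_ex by blast
  have "(fact n :: real) \<le> fact 4 * real n ^ b"
    using fact_add_le[of 4 b] b by simp
  also have "\<dots> = 3 / 32 * (4 ^ 4 * real n ^ b)" by (simp add: fact_numeral)
  also have "\<dots> \<le> 3 / 32 * (real n ^ 4 * real n ^ b)"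
    using assms by (intro mult_left_mono mult_right_mono power_mono) auto
  also have "real n ^ 4 * real n ^ b = real n ^ n" unfolding b by (simp add: power_add)
  finally show ?thesis .
qed

lemma coprime_one_add_mult: "coprime (1 + k * b) b" for k b :: nat
  by (metis coprime_1_left coprime_iff_gcd_eq_1 gcd.commute gcd_add_mult add.commute)

text \<open>The least \<open>l \<equiv> 1 (mod b)\<close> satisfying the first inequality overshoots by at most one
  step of length \<open>b\<close>.\<close>

lemma exists_coprime_order:
  fixes h c A :: real and b :: nat
  assumes h: "h > 0" and c: "c \<ge> 0" and A: "A \<ge> 0" and b: "b \<ge> 1"
  obtains l :: nat where "l \<ge> 2" "coprime l b"
    "h + c + ln (real l) \<le> real l * (ln (real l) - 1 - A)"
    "real l * (ln (real l) - 1 - A) \<le> h + c + ln (real l) + real b * ln (real l)"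
proof -
  define L where "L = (\<lambda>k. 1 + k * b)"
  define P where "P = (\<lambda>k. h + c + ln (real (L k)) \<le> real (L k) * (ln (real (L k)) - 1 - A))"
  \<comment> \<open>This threshold makes the bracket at least 2, so one copy of \<open>L k0\<close>
    covers \<open>h + c\<close> and another covers its logarithm.\<close>
  obtain k0 :: nat where k0: "real k0 \<ge> max (exp (3 + A)) (h + c)"
    using real_arch_simple by blast
  have "real k0 * 1 \<le> real k0 * real b" using b by (intro mult_left_mono) auto
  then have "real (L k0) \<ge> real k0" by (simp add: L_def)
  with k0 have L0: "real (L k0) \<ge> exp (3 + A)" "real (L k0) \<ge> h + c" by auto
  have "L k > 0" for k by (simp add: L_def)
  then have pos: "real (L k) > 0" for k by (simp only: of_nat_0_less_iff)
  have "ln (real (L k0)) \<ge> 3 + A" using L0(1) pos by (subst ln_ge_iff) auto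
  then have "real (L k0) * 2 \<le> real (L k0) * (ln (real (L k0)) - 1 - A)"
    by (intro mult_left_mono) auto
  moreover have "ln (real (L k0)) \<le> real (L k0)" using ln_le_half[OF pos[of k0]] pos[of k0] by linarith
  ultimately have "P k0" unfolding P_def using L0(2) by linarith
  define k where "k = (LEAST k. P k)"
  have Pk: "P k" unfolding k_def by (rule LeastI[of P, OF \<open>P k0\<close>])
  \<comment> \<open>For \<open>L 0 = 1\<close> the right side is -1 - A < 0, so the least solution
    has a predecessor that fails.\<close>
  have "\<not> P 0" using h c A by (simp add: P_def L_def)
  with Pk have "k \<noteq> 0" by metis
  then obtain k' where k': "k = Suc k'" using not0_implies_Suc by blast
  have nP: "\<not> P k'" using not_less_Least[of k' P] k' unfolding k_def by simp
  define l where "l = L k"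
  define l' where "l' = L k'"
  have ll': "l = l' + b" by (simp add: l_def l'_def L_def k')
  have l1: "l' \<ge> 1" by (simp add: l'_def L_def)
  define y y' where "y = ln (real l)" and "y' = ln (real l')"
  \<comment> \<open>Over one step the growth of the logarithm contributes at most \<open>b\<close>,
    which the term \<open>- real b\<close> in the expansion of the product absorbs.\<close>
  have "y - y' = ln (real l / real l')" using l1 ll' by (simp add: y_def y'_def ln_div)
  also have "\<dots> \<le> real l / real l' - 1" using l1 ll' by (intro ln_le_minus_one) auto
  also have "\<dots> = real b / real l'" using l1 by (simp add: ll' field_simps)
  finally have "real l' * (y - y') \<le> real l' * (real b / real l')" by (intro mult_left_mono) auto
  then have "real l' * (y - y') \<le> real b" using l1 by simp
  moreover have "real l * (y - 1 - A) =
      real l' * (y' - 1 - A) + real l' * (y - y') + real b * y - real b - real b * A"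
    by (simp add: ll' algebra_simps)
  moreover have "real l' * (y' - 1 - A) < h + c + y'"
    using nP by (simp add: P_def l'_def y'_def)
  moreover have "y' \<le> y" using l1 ll' by (simp add: y_def y'_def)
  moreover have "real b * A \<ge> 0" using A by simp
  ultimately have "real l * (y - 1 - A) \<le> h + c + y + real b * y" by linarith
  moreover have "l \<ge> 2" using ll' l1 b by linarith
  moreover have "coprime l b" unfolding l_def L_def by (rule coprime_one_add_mult)
  moreover have "h + c + y \<le> real l * (y - 1 - A)" using Pk by (simp add: P_def l_def y_def)
  ultimately show ?thesis using that unfolding y_def by blast
qed

text \<open>Coprimality to n! costs an overshoot of about n! ln l. The size of \<open>h\<close>
  forces ln l >= s, so \<open>l\<close> is so large compared with n^n that the overshoot fits into l
  / 2.\<close>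

lemma exists_hermite_order:
  fixes h :: real and n N :: nat
  defines "s \<equiv> real n * (ln (real n))\<^sup>2"
  assumes n: "n \<ge> 4" and h: "h \<ge> s * exp s"
  obtains l u where "l \<ge> 2" "coprime l (fact n)" "u = ln (real l) - 1 - real N * ln (real n)"
    "u > 0" "h + (2 * real n + ln 2 + ln (real l)) \<le> real l * u" "real l * u \<le> h + real l / 2"
    "s + ln s \<le> ln h" "ln h \<le> ln (real l) + ln u"
proof -
  define a where "a = real n * ln (real n)"
  have ln4: "5 / 4 \<le> ln (real n)" using n by (rule ln_ge_5_4)
  have s_a: "s = a * ln (real n)" by (simp add: s_def a_def power2_eq_square)
  have a4: "a \<ge> 4 * (5 / 4)" unfolding a_def using n ln4 by (intro mult_mono) auto
  have "a * (5 / 4) \<le> s" unfolding s_a using a4 ln4 by (intro mult_left_mono) auto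
  then have sa: "s \<ge> 5 / 4 * a" by simp
  then have s0: "s > 0" using a4 by linarith
  have "real n * (5 / 4) \<le> a" unfolding a_def using ln4 by (intro mult_left_mono) auto
  then have na: "real n \<le> 4 / 5 * a" by simp
  have "s * exp s > 0" using s0 by simp
  then have h0: "h > 0" using h by linarith
  define A where "A = real N * ln (real n)"
  have A0: "A \<ge> 0" unfolding A_def using ln4 by simp
  obtain l where l: "l \<ge> 2" "coprime l (fact n)"
    "h + (2 * real n + ln 2) + ln (real l) \<le> real l * (ln (real l) - 1 - A)"
    "real l * (ln (real l) - 1 - A) \<le> h + (2 * real n + ln 2) + ln (real l) + real (fact n) * ln (real l)"
  proof (rule exists_coprime_order[OF h0 _ A0, of "2 * real n + ln 2" "fact n"])
    show "2 * real n + ln 2 \<ge> 0" by simp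
  qed (auto intro: fact_ge_1)
  define y where "y = ln (real l)"
  define u where "u = y - 1 - A"
  have y0: "y > 0" using l(1) by (simp add: y_def)
  have ly: "real l = exp y" using l(1) by (simp add: y_def)
  have ln2: "0 < ln (2 :: real)" "ln (2::real) \<le> 1" using ln_le_minus_one[of "2::real"] by auto
  have hlu: "h \<le> real l * u" using l(3) y0 ln2 unfolding u_def y_def[symmetric] by linarith
  then have "real l * u > 0" using h0 by linarith
  then have u0: "u > 0" using l(1) by (simp add: zero_less_mult_iff)
  \<comment> \<open>Otherwise monotonicity of x exp x would contradict h <= l u <= l ln l.\<close>
  have ys: "s \<le> y"
  proof (rule ccontr)
    assume "\<not> s \<le> y"
    then have "y * exp y < s * exp s" using y0 by (intro mult_strict_mono) auto
    also have "\<dots> \<le> exp y * u" using h hlu unfolding ly by linarith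
    also have "\<dots> \<le> exp y * y" using A0 by (simp add: u_def)
    finally show False by simp
  qed
  have "real (fact n) * y + (2 * real n + ln 2 + y) \<le> real l / 2"
  proof -
    have ea: "real n ^ n = exp a"
      unfolding a_def using n by (simp add: exp_of_nat_mult)
    have "(4::real) ^ 4 \<le> real n ^ 4" using n by (intro power_mono) auto
    also have "\<dots> \<le> real n ^ n" using n by (intro power_increasing) auto
    finally have ea4: "256 \<le> exp a" unfolding ea by simp
    have "2 * real n + ln 2 + y \<le> 3 * y" using na sa ys ln2 a4 by linarith
    also have "\<dots> = 3 / 256 * y * 256" by simp
    also have "\<dots> \<le> 3 / 256 * y * exp a" using ea4 y0 by (intro mult_left_mono) auto
    finally have 1: "2 * real n + ln 2 + y \<le> 3 / 256 * y * exp a" .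
    have "real (fact n) * y \<le> 3 / 32 * exp a * y"
      using fact_le_power_self[OF n] y0 unfolding ea by (intro mult_right_mono) auto
    with 1 have "real (fact n) * y + (2 * real n + ln 2 + y) \<le> exp a * (27 / 256 * y)"
      by (simp add: algebra_simps)
    \<comment> \<open>Here a <= 4 y / 5, and 27 / 256 = 3 / 32 + 3 / 256 lies below 1 / 5.\<close>
    also have "27 / 256 * y \<le> exp (y - a) / 2"
    proof -
      have "y / 5 \<le> y - a" using sa ys by argo
      then show ?thesis using two_mult_le_exp[of "y - a"] y0 by argo
    qed
    then have "exp a * (27 / 256 * y) \<le> exp a * (exp (y - a) / 2)"
      by (intro mult_left_mono) auto
    also have "\<dots> = real l / 2" by (simp add: ly flip: exp_add)
    finally show ?thesis .
  qed
  then have lu_h: "real l * u \<le> h + real l / 2"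
    using l(4) unfolding u_def y_def by linarith
  have "ln (s * exp s) \<le> ln h"
    using h \<open>s * exp s > 0\<close> by (subst ln_le_cancel_iff) auto
  then have "s + ln s \<le> ln h" using s0 by (simp add: ln_mult)
  moreover have "ln h \<le> ln (real l * u)" using hlu h0 by (subst ln_le_cancel_iff) auto
  then have "ln h \<le> ln (real l) + ln u" using u0 l(1) by (simp add: ln_mult)
  ultimately show ?thesis
    using that[of l u] l u0 lu_h unfolding u_def y_def A_def by (simp add: add_ac)
qed

section \<open>Numerical comparison of X = ln ln H with u - 1/2\<close>

lemma hermite_order_ineq_12_88:
  fixes n N :: nat and u X :: real
  defines "s \<equiv> real n * (ln (real n))\<^sup>2"
  assumes n: "n \<ge> 4" and N: "N \<le> n" and u: "u > 0"
    and X: "s + ln s \<le> X" "X \<le> u + ln u + 1 + real N * ln (real n)"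
  shows "X < 12.88 * (u - 1 / 2)"
proof -
  define a where "a = real n * ln (real n)"
  have ln4: "5 / 4 \<le> ln (real n)" using n by (rule ln_ge_5_4)
  have s_a: "s = a * ln (real n)" by (simp add: s_def a_def power2_eq_square)
  have a4: "a \<ge> 4 * (5 / 4)" unfolding a_def using n ln4 by (intro mult_mono) auto
  have "a * (5 / 4) \<le> s" unfolding s_a using a4 ln4 by (intro mult_left_mono) auto
  then have sa: "s \<ge> 5 / 4 * a" by simp
  define A where "A = real N * ln (real n)"
  have Aa: "A \<le> a" unfolding a_def A_def using N ln4 by (intro mult_right_mono) auto
  have "ln u \<le> u - 1" using u by (rule ln_le_minus_one)
  moreover have "1 \<le> ln s" using sa a4 e_less_272 by (subst ln_ge_iff) auto
  \<comment> \<open>Since a >= 5, this yields u - 1/2 >= 5/8 and X <= 10 (u - 1/2) + 1, so even the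
    factor 11.6 would do.\<close>
  ultimately have "u \<ge> a / 8 + 1 / 2" "X \<le> 2 * u + a"
    using X sa Aa unfolding A_def[symmetric] by argo+
  then have "X < 1288 / 100 * (u - 1 / 2)" using a4 by argo
  then show ?thesis by (simp add: power2_eq_square)
qed

text \<open>Failure would give u <= ln u + 2 + a with a = n ln n, so X would be at most 2 a plus a
  logarithmic term. But X >= s >= 47 a / 20, which is too large once a >= 11 * 47 / 20.\<close>

lemma hermite_order_ineq_2:
  fixes n N :: nat and u X :: real
  defines "s \<equiv> real n * (ln (real n))\<^sup>2"
  assumes n: "n \<ge> 11" and N: "N \<le> n" and u: "u > 0"
    and X: "s + ln s \<le> X" "X \<le> u + ln u + 1 + real N * ln (real n)"
  shows "X < 2 * (u - 1 / 2)"
proof (rule ccontr)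
  assume neg: "\<not> ?thesis"
  define a where "a = real n * ln (real n)"
  have ln11: "47 / 20 \<le> ln (real n)" using n by (rule ln_ge_47_20)
  have s_a: "s = a * ln (real n)" by (simp add: s_def a_def power2_eq_square)
  have a11: "a \<ge> 11 * (47 / 20)" unfolding a_def using n ln11 by (intro mult_mono) auto
  have "a * (47 / 20) \<le> s" unfolding s_a using a11 ln11 by (intro mult_left_mono) auto
  then have sa: "s \<ge> 47 / 20 * a" by simp
  have "ln a \<le> ln s" using sa a11 by (subst ln_le_cancel_iff) auto
  define A where "A = real N * ln (real n)"
  have Aa: "A \<le> a" unfolding a_def A_def using N ln11 by (intro mult_right_mono) auto
  have "u \<le> ln u + 2 + a" using neg X(2) Aa unfolding A_def[symmetric] by argo
  moreover from this have "u \<le> 11 / 5 * a" using ln_le_half[OF u] a11 by argo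
  then have "ln u \<le> ln (11 / 5 * a)" using u a11 by (subst ln_le_cancel_iff) auto
  moreover have "ln (11 / 5 * a) = ln (11 / 5) + ln a" by (rule ln_mult_pos) (use a11 in auto)
  moreover have "ln (11 / 5 :: real) = ln 2 + ln (11 / 10)" using ln_mult_pos[of 2 "11 / 10 :: real"] by simp
  moreover have "ln (11 / 10 :: real) \<le> 1 / 10" using ln_le_minus_one[of "11 / 10 :: real"] by simp
  \<comment> \<open>The tangent to the logarithm at 16 bounds ln a linearly, with ln 16 = 4 ln
    2.\<close>
  moreover have "ln (a / 16) \<le> a / 16 - 1" using a11 by (intro ln_le_minus_one) auto
  moreover have "ln (a / 16) = ln a - 4 * ln 2" using a11 ln_realpow[of 2 4] by (simp add: ln_div)
  moreover note ln2_le_25_over_36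
  ultimately show False using X Aa sa a11 \<open>ln a \<le> ln s\<close> unfolding A_def[symmetric] by linarith
qed

section \<open>From the order l to a power of H\<close>

lemma fact_quotient_le:
  assumes "l \<ge> 1"
  shows "(fact (Suc m * l - 1) :: real) \<le> fact (l - 1) * (real (Suc m) ^ (Suc m * l) * fact l ^ m)"
proof -
  define K where "K = Suc m * l"
  have K: "K \<ge> l" by (simp add: K_def)
  have "real l * fact (K - 1) \<le> real K * fact (K - 1)" using K by (intro mult_right_mono) auto
  also have "\<dots> = fact K" using assms K by (simp add: fact_reduce)
  also have "\<dots> \<le> real (Suc m) ^ K * fact l ^ Suc m"
    unfolding K_def by (rule fact_mult_le)
  \<comment> \<open>One of the m + 1 factors l! cancels; the other m, each close to H up to powers
    of n, produce the exponent m.\<close>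
  also have "\<dots> = fact l * (real (Suc m) ^ K * fact l ^ m)" by (simp add: mult_ac)
  also have "\<dots> = real l * (fact (l - 1) * (real (Suc m) ^ K * fact l ^ m))"
    using fact_reduce[of l, where 'a = real] assms by simp
  finally have "real l * fact (K - 1) \<le> real l * (fact (l - 1) * (real (Suc m) ^ K * fact l ^ m))" .
  then show ?thesis using assms unfolding K_def by simp
qed

lemma bound_exp_mult:
  "bound_exp \<rho> m n H * L =
    - (real m * L) - \<rho> * (real (Suc m) * (real (Suc m) + 1)) * ln (real n) * (L / ln (ln H))"
proof -
  have "real m ^ 2 + 3 * real m + 2 = real (Suc m) * (real (Suc m) + 1)"
    by (simp add: algebra_simps power2_eq_square)
  then show ?thesis unfolding bound_exp_def by (simp only: left_diff_distrib) simp
qed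

text \<open>Taking logarithms, -ln \<open>\<Lambda>\<close> is at most m h + N (N + 1) l ln n with N
  = m + 1, and l < \<open>\<rho>\<close> h / ln h.\<close>

lemma powr_bound_exp_less:
  fixes m n l :: nat and H u \<rho> \<Lambda> :: real
  defines "h \<equiv> ln H" and "y \<equiv> ln (real l)"
  assumes n: "n \<ge> 4" and m: "Suc m \<le> n" and H: "H > 0" and l: "l \<ge> 1"
    and u: "u = y - 1 - real (Suc m) * ln (real n)"
    and lo: "h + (2 * real n + ln 2 + y) \<le> real l * u" and hi: "real l * u \<le> h + real l / 2"
    and X: "ln h > 0" "ln h < \<rho> * (u - 1 / 2)" and \<rho>: "\<rho> > 0"
    and \<Lambda>: "fact (l - 1) / 2 \<le> fact (Suc m * l - 1) * exp (real n) * \<Lambda>"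
  shows "H powr bound_exp \<rho> m n H < \<Lambda>"
proof -
  define N where "N = real (Suc m)"
  \<comment> \<open>The overshoot in the choice of \<open>l\<close>: large enough to absorb
    lower-order terms, yet at most l / 2.\<close>
  define E where "E = real l * u - h"
  have ln_n: "1 \<le> ln (real n)" using ln_ge_5_4[OF n] by simp
  have N1: "N \<ge> 1" by (simp add: N_def)
  have y0: "y \<ge> 0" using l by (simp add: y_def)
  have ln2: "0 < ln (2 :: real)" by simp
  have E: "2 * real n + ln 2 + y \<le> E" "E \<le> real l / 2" using lo hi by (auto simp: E_def)
  have lN: "ln N \<le> ln (real n)" unfolding N_def using m by simp
  have "ln (fact l) \<le> real l * y - real l + 1 + y" unfolding y_def by (rule ln_fact_le[OF l])
  also have "\<dots> = h + E + real l * (N * ln (real n)) + 1 + y"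
    by (simp add: E_def u N_def algebra_simps)
  finally have lf: "ln (fact l) \<le> h + E + real l * (N * ln (real n)) + 1 + y" .
  define Q where "Q = 2 * exp (real n) * (N ^ (Suc m * l) * fact l ^ m)"
  have Q0: "Q > 0" unfolding Q_def N_def by simp
  have "0 < fact (Suc m * l - 1) * exp (real n) * \<Lambda>"
    by (rule less_le_trans[OF _ \<Lambda>]) simp
  then have \<Lambda>0: "\<Lambda> > 0" by (rule zero_less_mult_pos) simp
  have "fact (l - 1) / 2 \<le> (fact (l - 1) * (N ^ (Suc m * l) * fact l ^ m)) * exp (real n) * \<Lambda>"
    by (rule order_trans[OF \<Lambda>], unfold N_def, intro mult_right_mono fact_quotient_le l) (use \<Lambda>0 in auto)
  then have "fact (l - 1) * 1 \<le> fact (l - 1) * (Q * \<Lambda>)" by (simp add: Q_def mult_ac)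
  then have "1 \<le> Q * \<Lambda>" by (subst (asm) mult_le_cancel_left_pos) auto
  then have "ln 1 \<le> ln (Q * \<Lambda>)" by (subst ln_le_cancel_iff) auto
  then have lnL: "ln \<Lambda> \<ge> - ln Q" using Q0 \<Lambda>0 by (simp add: ln_mult)
  have "ln Q = ln 2 + real n + N * real l * ln N + real m * ln (fact l)"
    unfolding Q_def using N1 by (simp add: ln_mult ln_realpow N_def algebra_simps)
  also have "\<dots> \<le> ln 2 + real n + N * real l * ln (real n)
      + real m * (h + E + real l * (N * ln (real n)) + 1 + y)"
    using lN lf N1 by (intro add_mono mult_left_mono) auto
  also have "\<dots> = real m * h + real l * N\<^sup>2 * ln (real n) + (ln 2 + real n + real m * (1 + y)) + real m * E"
    by (simp add: N_def algebra_simps power2_eq_square)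
  \<comment> \<open>The main terms account for N^2; lower-order terms and the overshoot cost at most
    2 N E <= N l, which raises N^2 to N (N + 1).\<close>
  also have "\<dots> \<le> real m * h + real l * N\<^sup>2 * ln (real n) + N * real l * ln (real n)"
  proof -
    have "ln 2 + real n + real m * (1 + y) \<le> N * (2 * real n + ln 2 + y)"
    proof -
      have "real m * 1 \<le> real m * (2 * real n + ln 2)" using n ln2 by (intro mult_left_mono) linarith+
      then show ?thesis using y0 by (simp add: N_def algebra_simps)
    qed
    also have "\<dots> \<le> N * E" using E N1 by (intro mult_left_mono) auto
    finally have "ln 2 + real n + real m * (1 + y) + real m * E \<le> N * E + real m * E" by simp
    also have "\<dots> \<le> 2 * N * E"
    proof -
      have "E \<ge> 0" using E(1) y0 ln2 by linarith
      then show ?thesis by (simp add: N_def algebra_simps)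
    qed
    also have "\<dots> \<le> 2 * N * (real l / 2)" using E N1 by (intro mult_left_mono) auto
    also have "\<dots> = N * real l * 1" by simp
    also have "\<dots> \<le> N * real l * ln (real n)" using ln_n N1 by (intro mult_left_mono) auto
    finally show ?thesis by simp
  qed
  also have "\<dots> = real m * h + N * (N + 1) * ln (real n) * real l"
    by (simp add: algebra_simps power2_eq_square)
  also have "\<dots> < real m * h + N * (N + 1) * ln (real n) * (\<rho> * h / ln h)"
  proof -
    \<comment> \<open>The summand l / 2 in \<open>hi\<close> is what turns u into u - 1/2: l (u -
      1/2) <= h.\<close>
    have "real l * ln h < real l * (\<rho> * (u - 1 / 2))"
      using X l by (intro mult_strict_left_mono) auto
    also have "\<dots> = \<rho> * (real l * u - real l / 2)" by (simp add: algebra_simps)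
    also have "\<dots> \<le> \<rho> * h" using hi \<rho> by (intro mult_left_mono) auto
    finally have "real l < \<rho> * h / ln h" using X(1) by (simp add: field_simps)
    moreover have "N * (N + 1) * ln (real n) > 0" using N1 ln_n by simp
    ultimately show ?thesis by (intro add_strict_left_mono mult_strict_left_mono)
  qed
  finally have "bound_exp \<rho> m n H * h < ln \<Lambda>"
    using lnL unfolding bound_exp_mult h_def N_def by (simp add: algebra_simps)
  then have "exp (bound_exp \<rho> m n H * h) < exp (ln \<Lambda>)" by simp
  then show ?thesis using H \<Lambda>0 by (simp add: powr_def h_def)
qed

theorem theorem9p1:
  fixes d :: int and m1 m2 :: nat and \<beta> :: "nat \<Rightarrow> nat" and H :: real
  assumes "d < 0"
    and "m1 \<ge> 1" and "m2 \<ge> 4" and "m2 \<ge> m1 + 1"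
    and "\<beta> 0 = 0" and "inj_on \<beta> {0..m1}" and "Max (\<beta> ` {0..m1}) = m2"
    and "H > 0"
    and "ln H \<ge> real m2 * (ln (real m2))^2 * exp (real m2 * (ln (real m2))^2)"
  shows "\<forall>lam :: nat \<Rightarrow> complex.
           (\<forall>i\<le>m1. lam i \<in> ring_of_integers_iqf d) \<and> (\<exists>i\<le>m1. lam i \<noteq> 0) \<and>
           (\<forall>i\<in>{1..m1}. cmod (lam i) \<le> H) \<longrightarrow>
           cmod (\<Sum>i=0..m1. lam i * complex_of_real (exp 1) ^ \<beta> i) > H powr bound_exp 12.88 m1 m2 H
           \<and> (m2 \<ge> 11 \<longrightarrow>
              cmod (\<Sum>i=0..m1. lam i * complex_of_real (exp 1) ^ \<beta> i) > H powr bound_exp 2 m1 m2 H)"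
proof (intro allI impI, elim conjE)
  fix lam :: "nat \<Rightarrow> complex"
  assume lam: "\<forall>i\<le>m1. lam i \<in> ring_of_integers_iqf d" "\<exists>i\<le>m1. lam i \<noteq> 0"
    "\<forall>i\<in>{1..m1}. cmod (lam i) \<le> H"
  define s where "s = real m2 * (ln (real m2))\<^sup>2"
  define h where "h = ln H"
  define N where "N = Suc m1"
  have N: "N \<le> m2" using assms(4) by (simp add: N_def)
  obtain l u where l: "l \<ge> 2" "coprime l (fact m2)" and u: "u = ln (real l) - 1 - real N * ln (real m2)"
    and u0: "u > 0" and lo: "h + (2 * real m2 + ln 2 + ln (real l)) \<le> real l * u"
    and hi: "real l * u \<le> h + real l / 2" and X: "s + ln s \<le> ln h" "ln h \<le> ln (real l) + ln u"
    using exists_hermite_order[OF assms(3) assms(9), of N] unfolding s_def h_def by metis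
  have X2: "ln h \<le> u + ln u + 1 + real N * ln (real m2)" using X(2) u by linarith
  \<comment> \<open>Positivity of ln ln H is needed because it is the denominator of the
    exponent.\<close>
  have "4 * (5 / 4)\<^sup>2 \<le> s"
    unfolding s_def using assms(3) ln_ge_5_4[OF assms(3)] by (intro mult_mono power_mono) auto
  then have "s > 1" by (simp add: power2_eq_square)
  then have X0: "ln h > 0" using X(1) ln_gt_zero[of s] by linarith
  have exp_eq: "complex_of_real (exp 1) ^ b = complex_of_real (exp (real b))" for b
    by (simp flip: of_real_power exp_of_nat_mult)
  have small: "real m1 * H * real m2 ^ (N * l) * exp (real m2) \<le> fact (l - 1) / 2"
  proof -
    have "ln (real m1) \<le> real m1 - 1" using assms(2) by (intro ln_le_minus_one) auto
    then have lm: "ln (real m1) \<le> real m2" using assms(4) by linarith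
    have fl: "(fact l :: real) = real l * fact (l - 1)" using l(1) by (simp add: fact_reduce)
    \<comment> \<open>After multiplication by 2 l the claim compares with l!; by the choice of
      \<open>u\<close> the logarithm is at most l ln l - l.\<close>
    have "ln (2 * (real m1 * H * real m2 ^ (N * l) * exp (real m2)) * real l) =
        ln 2 + ln (real m1) + h + real l * (real N * ln (real m2)) + real m2 + ln (real l)"
      using assms(2,3,8) l(1) by (simp add: ln_mult ln_realpow h_def)
    also have "\<dots> \<le> real l * u + real l * (real N * ln (real m2))"
      using lo lm by linarith
    also have "\<dots> = real l * ln (real l) - real l" by (simp add: u algebra_simps)
    also have "\<dots> \<le> ln (fact l)" by (rule ln_fact_ge)
    finally have "2 * (real m1 * H * real m2 ^ (N * l) * exp (real m2)) * real l \<le> fact l"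
      using assms(2,3,8) l(1) by (subst (asm) ln_le_cancel_iff) auto
    then have "real l * (2 * (real m1 * H * real m2 ^ (N * l) * exp (real m2))) \<le> real l * fact (l - 1)"
      unfolding fl by (simp only: mult_ac)
    then have "2 * (real m1 * H * real m2 ^ (N * l) * exp (real m2)) \<le> fact (l - 1)"
      using l(1) by (subst (asm) mult_le_cancel_left_pos) auto
    then show ?thesis by simp
  qed
  have \<beta>: "\<beta> j \<le> m2" if "j \<le> m1" for j
    using assms(7) Max_ge[of "\<beta> ` {0..m1}" "\<beta> j"] that by auto
  define \<Lambda> where "\<Lambda> = (\<Sum>i=0..m1. lam i * complex_of_real (exp 1) ^ \<beta> i)"
  have \<Lambda>_alt: "\<Lambda> = (\<Sum>j\<le>m1. lam j * complex_of_real (exp (real (\<beta> j))))"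
    unfolding \<Lambda>_def exp_eq atLeast0AtMost ..
  have lower: "fact (l - 1) / 2 \<le> fact (Suc m1 * l - 1) * exp (real m2) * cmod \<Lambda>"
    unfolding \<Lambda>_alt
  proof (rule exp_linear_form_lower_bound[where d = d and H = H])
    show "inj_on \<beta> {..m1}" using assms(6) by (simp add: atLeast0AtMost)
    show "quad_int d (lam j)" if "j \<le> m1" for j
      using ring_of_integers_iqf_quad_int[OF assms(1)] lam(1) that by blast
    show "real m1 * H * real m2 ^ (Suc m1 * l) * exp (real m2) \<le> fact (l - 1) / 2"
      using small by (simp only: N_def)
  qed (use lam assms l \<beta> in auto)
  have bound: "H powr bound_exp \<rho> m1 m2 H < cmod \<Lambda>" if "ln h < \<rho> * (u - 1 / 2)" "\<rho> > 0" for \<rho>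
    by (rule powr_bound_exp_less[where l = l and u = u])
       (use assms N l u lo hi X0 that lower in \<open>auto simp: h_def N_def\<close>)
  have "ln h < 12.88 * (u - 1 / 2)"
    using hermite_order_ineq_12_88[OF assms(3) N u0 _ X2] X(1) by (simp add: s_def)
  moreover have "ln h < 2 * (u - 1 / 2)" if "m2 \<ge> 11"
    using hermite_order_ineq_2[OF that N u0 _ X2] X(1) by (simp add: s_def)
  ultimately show "cmod (\<Sum>i=0..m1. lam i * complex_of_real (exp 1) ^ \<beta> i) > H powr bound_exp 12.88 m1 m2 H
      \<and> (m2 \<ge> 11 \<longrightarrow>
        cmod (\<Sum>i=0..m1. lam i * complex_of_real (exp 1) ^ \<beta> i) > H powr bound_exp 2 m1 m2 H)"
    using bound unfolding \<Lambda>_def[symmetric] by auto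
qed

end
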